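(* Let $K$ be a field and let $I\subset S:=K[x_1,x_2,x_3]$ be a monomial ideal which is not principal. If $I=I^{sat}$ then $\operatorname{sdepth}(I)=2$.
   Context: $I^{sat}=\bigcup_{k\geq1}(I:(x_1,x_2,x_3)^k)$ is the saturation of $I$. A Stanley decomposition of a nonzero monomial ideal $I\subset S$ is a decomposition $\mathcal D:\ I=\bigoplus_{i=1}^r u_iK[Z_i]$ as a $K$-vector space, where $u_i\in S$ are monomials and $Z_i$ are subsets of the set of variables of $S$; $u_iK[Z_i]$ is the $K$-span of the monomials $u_iw$ with $w$ a monomial in the variables of $Z_i$. Put $\operatorname{sdepth}(\mathcal D)=\min_i|Z_i|$, and let $\operatorname{sdepth}(I)$ be the maximum of $\operatorname{sdepth}(\mathcal D)$ over all Stanley decompositions of $I$. *)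

theory Defs
  imports Complex_Main "HOL-Library.Poly_Mapping" "HOL-Library.Numeral_Type"
begin

(* Polynomials over 'k in variables indexed by 'x: finitely supported functions from
   exponent vectors to coefficients, with the convolution product of Poly_Mapping. *)
type_synonym ('x, 'k) mpoly = "('x \<Rightarrow>\<^sub>0 nat) \<Rightarrow>\<^sub>0 'k"

definition monom :: "('x \<Rightarrow>\<^sub>0 nat) \<Rightarrow> ('x, 'k::field) mpoly" where
  "monom m = Poly_Mapping.single m 1"

definition var :: "'x \<Rightarrow> ('x, 'k::field) mpoly" where
  "var x = monom (Poly_Mapping.single x 1)"

definition scale :: "'k::field \<Rightarrow> ('x, 'k) mpoly \<Rightarrow> ('x, 'k) mpoly" where
  "scale c p = Poly_Mapping.single 0 c * p"

(* A commutative ring as a module over itself: its submodules are the ideals. *)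
global_interpretation ring_module: module "(*) :: 'a::comm_ring_1 \<Rightarrow> 'a \<Rightarrow> 'a"
  by unfold_locales (simp_all add: algebra_simps)

global_interpretation mpoly: vector_space
  "scale :: 'k::field \<Rightarrow> ('x, 'k) mpoly \<Rightarrow> ('x, 'k) mpoly"
  by unfold_locales
    (simp_all add: scale_def distrib_left distrib_right single_add mult_single
      flip: mult.assoc)

abbreviation ideal_generated :: "'a::comm_ring_1 set \<Rightarrow> 'a set" where
  "ideal_generated \<equiv> ring_module.span"

definition principal_ideal :: "'a::comm_ring_1 set \<Rightarrow> bool" where
  "principal_ideal I \<longleftrightarrow> (\<exists>f. I = ideal_generated {f})"

definition ideal_prod :: "'a::comm_ring_1 set \<Rightarrow> 'a set \<Rightarrow> 'a set" where
  "ideal_prod I J = ideal_generated {a * b | a b. a \<in> I \<and> b \<in> J}"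

primrec ideal_power :: "'a::comm_ring_1 set \<Rightarrow> nat \<Rightarrow> 'a set" where
  "ideal_power I 0 = UNIV"
| "ideal_power I (Suc k) = ideal_prod I (ideal_power I k)"

definition ideal_quotient :: "'a::comm_ring_1 set \<Rightarrow> 'a set \<Rightarrow> 'a set" where
  "ideal_quotient I J = {f. \<forall>g\<in>J. f * g \<in> I}"

definition saturation :: "('x, 'k::field) mpoly set \<Rightarrow> ('x, 'k) mpoly set" where
  "saturation I = (\<Union>k\<in>{1..}. ideal_quotient I (ideal_power (ideal_generated (range var)) k))"

definition monomial_ideal :: "('x, 'k::field) mpoly set \<Rightarrow> bool" where
  "monomial_ideal I \<longleftrightarrow> (\<exists>M. I = ideal_generated (monom ` M))"

(* u K[Z], the monomial u being given by its exponent vector *)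
definition stanley_space :: "('x \<Rightarrow>\<^sub>0 nat) \<Rightarrow> 'x set \<Rightarrow> ('x, 'k::field) mpoly set" where
  "stanley_space u Z = mpoly.span {monom u * monom w | w. Poly_Mapping.keys w \<subseteq> Z}"

definition internal_direct_sum :: "'a::comm_monoid_add set \<Rightarrow> nat \<Rightarrow> (nat \<Rightarrow> 'a set) \<Rightarrow> bool" where
  "internal_direct_sum W r V \<longleftrightarrow>
     W = {\<Sum>i<r. f i | f. \<forall>i<r. f i \<in> V i} \<and>
     (\<forall>f g. (\<forall>i<r. f i \<in> V i) \<and> (\<forall>i<r. g i \<in> V i) \<and> (\<Sum>i<r. f i) = (\<Sum>i<r. g i)
        \<longrightarrow> (\<forall>i<r. f i = g i))"

(* A decomposition is the list of its pairs (u_i, Z_i). It has to be nonempty, so that the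
   minimum in decomp_sdepth exists; this is automatic for a nonzero ideal. *)
definition stanley_decomposition ::
  "('x, 'k::field) mpoly set \<Rightarrow> (('x \<Rightarrow>\<^sub>0 nat) \<times> 'x set) list \<Rightarrow> bool" where
  "stanley_decomposition I D \<longleftrightarrow> D \<noteq> [] \<and>
     internal_direct_sum I (length D) (\<lambda>i. stanley_space (fst (D ! i)) (snd (D ! i)))"

definition decomp_sdepth :: "(('x \<Rightarrow>\<^sub>0 nat) \<times> 'x set) list \<Rightarrow> nat" where
  "decomp_sdepth D = Min ((\<lambda>(u, Z). card Z) ` set D)"

(* The set is finite, since decomp_sdepth is at most the number of variables. *)
definition sdepth :: "('x::finite, 'k::field) mpoly set \<Rightarrow> nat" where
  "sdepth I = Max {decomp_sdepth D | D. stanley_decomposition I D}"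

end

theory Submission
  imports "HOL-Analysis.Cartesian_Space" "HOL-Library.Disjoint_Sets" Defs
begin

text \<open>Two summands \<open>u S\<close> and \<open>v S\<close> meet in \<open>u v\<close>, so a decomposition of depth 3 has a single
  summand and the ideal is principal; hence the depth is at most 2.

  For the lower bound, cut the exponent set \<open>E\<close> into horizontal slices, which grow with the height
  \<open>c\<close> and become constant by Dickson's lemma. Saturation says that a point all of whose three upper
  neighbours lie in \<open>E\<close> lies in \<open>E\<close>. Hence a point of slice \<open>c\<close> outside slice \<open>c - 1\<close> never has both
  its planar neighbours in slice \<open>c - 1\<close>, which makes the difference of two consecutive slices a
  finite disjoint union of rays (and quadrants, for the first nonempty slice). Each of these is
  multiplied by the vertical direction.\<close>

section \<open>Subspaces spanned by monomials\<close>

lemma keys_scale: "Poly_Mapping.keys (scale c p) \<subseteq> Poly_Mapping.keys p"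
  using keys_mult[of "Poly_Mapping.single 0 c" p] by (auto simp: scale_def split: if_splits)

lemma sum_lookup_single:
  "(\<Sum>k\<in>Poly_Mapping.keys p. Poly_Mapping.single k (Poly_Mapping.lookup p k)) = p"
proof (rule poly_mapping_eqI)
  fix k
  show "Poly_Mapping.lookup (\<Sum>k\<in>Poly_Mapping.keys p. Poly_Mapping.single k (Poly_Mapping.lookup p k)) k
      = Poly_Mapping.lookup p k"
    by (cases "k \<in> Poly_Mapping.keys p")
      (auto simp: lookup_sum lookup_single when_def in_keys_iff)
qed

text \<open>Makes membership in a span of monomials a condition on supports. The left side is the
  smallest subspace containing the monomials, and every polynomial is the sum of its terms.\<close>

lemma span_monom:
  "(mpoly.span (monom ` A) :: ('x, 'k::field) mpoly set) = {p. Poly_Mapping.keys p \<subseteq> A}"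
proof (rule antisym)
  show "mpoly.span (monom ` A) \<subseteq> {p :: ('x, 'k) mpoly. Poly_Mapping.keys p \<subseteq> A}"
  proof (intro mpoly.span_minimal mpoly.subspaceI)
    show "x + y \<in> {p. Poly_Mapping.keys p \<subseteq> A}"
      if "x \<in> {p. Poly_Mapping.keys p \<subseteq> A}" "y \<in> {p. Poly_Mapping.keys p \<subseteq> A}" for x y :: "('x, 'k) mpoly"
      using that keys_add[of x y] by blast
    show "scale c x \<in> {p. Poly_Mapping.keys p \<subseteq> A}"
      if "x \<in> {p. Poly_Mapping.keys p \<subseteq> A}" for c :: 'k and x :: "('x, 'k) mpoly"
      using that keys_scale[of c x] by blast
  qed (auto simp: monom_def)
next
  show "{p :: ('x, 'k) mpoly. Poly_Mapping.keys p \<subseteq> A} \<subseteq> mpoly.span (monom ` A)"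
  proof
    fix p :: "('x, 'k) mpoly"
    assume p: "p \<in> {p. Poly_Mapping.keys p \<subseteq> A}"
    have "Poly_Mapping.single k (Poly_Mapping.lookup p k) \<in> mpoly.span (monom ` A)"
      if "k \<in> Poly_Mapping.keys p" for k
    proof -
      have "Poly_Mapping.single k (Poly_Mapping.lookup p k)
          = scale (Poly_Mapping.lookup p k) (monom k)"
        by (simp add: scale_def monom_def mult_single)
      moreover have "(monom k :: ('x, 'k) mpoly) \<in> mpoly.span (monom ` A)"
        using p that by (intro mpoly.span_base) auto
      ultimately show ?thesis
        by (simp add: mpoly.span_scale)
    qed
    then have "(\<Sum>k\<in>Poly_Mapping.keys p. Poly_Mapping.single k (Poly_Mapping.lookup p k))
        \<in> mpoly.span (monom ` A)"
      by (rule mpoly.span_sum)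
    then show "p \<in> mpoly.span (monom ` A)"
      by (simp add: sum_lookup_single)
  qed
qed

text \<open>Replaces the ideal by an upward closed set of exponents, after which only combinatorics
  remains. \<open>E\<close> consists of the exponents divisible by some generator. The polynomials
  supported on it are closed under arbitrary multiples because \<open>E\<close> is upward closed,
  and each of their terms is a multiple of a generator.\<close>

lemma monomial_ideal_keys:
  fixes I :: "('x, 'k::field) mpoly set"
  assumes "monomial_ideal I"
  obtains E where "I = {p. Poly_Mapping.keys p \<subseteq> E}" and "\<And>m w. m \<in> E \<Longrightarrow> m + w \<in> E"
proof -
  obtain M where M: "I = ideal_generated (monom ` M)"
    using assms by (auto simp: monomial_ideal_def)
  define E where "E = {m + w | m w. m \<in> M}"
  have up: "m + w \<in> E" if "m \<in> E" for m w
    using that by (auto simp: E_def) (metis add.assoc)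
  have "I \<subseteq> {p. Poly_Mapping.keys p \<subseteq> E}"
    unfolding M
  proof (intro ring_module.span_minimal ring_module.subspaceI)
    show "monom ` M \<subseteq> {p. Poly_Mapping.keys p \<subseteq> E}"
      by (auto simp: monom_def E_def) (metis add.right_neutral)
    show "x + y \<in> {p. Poly_Mapping.keys p \<subseteq> E}"
      if "x \<in> {p. Poly_Mapping.keys p \<subseteq> E}" "y \<in> {p. Poly_Mapping.keys p \<subseteq> E}" for x y :: "('x, 'k) mpoly"
      using that keys_add[of x y] by blast
    show "c * x \<in> {p. Poly_Mapping.keys p \<subseteq> E}"
      if "x \<in> {p. Poly_Mapping.keys p \<subseteq> E}" for c x :: "('x, 'k) mpoly"
      using that keys_mult[of c x] up by (fastforce simp: add.commute)
  qed simp
  moreover have "p \<in> I" if "Poly_Mapping.keys p \<subseteq> E" for p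
  proof -
    have "Poly_Mapping.single k c \<in> I" if k: "k \<in> E" for k c
    proof -
      obtain m w where "k = m + w" "m \<in> M"
        using k by (auto simp: E_def)
      then have "Poly_Mapping.single k c = Poly_Mapping.single w c * monom m" "monom m \<in> I"
        by (auto simp: monom_def mult_single add.commute M intro: ring_module.span_base)
      then show ?thesis
        unfolding M by (metis ring_module.span_scale)
    qed
    then have "(\<Sum>k\<in>Poly_Mapping.keys p. Poly_Mapping.single k (Poly_Mapping.lookup p k)) \<in> I"
      using that unfolding M by (intro ring_module.span_sum) auto
    then show ?thesis
      by (simp add: sum_lookup_single)
  qed
  ultimately have "I = {p. Poly_Mapping.keys p \<subseteq> E}"
    by blast
  then show thesis
    using that up by blast
qed

text \<open>The multipliers that send \<open>f\<close> into \<open>I\<close> form an ideal, so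
  testing the variables suffices for the whole maximal ideal. This is the quotient for
  \<open>k = 1\<close>, which already lies in the union that defines the saturation.\<close>

lemma monom_times_mem_saturation:
  fixes I :: "('x, 'k::field) mpoly set"
  assumes "I = ideal_generated G" and "\<And>x. f * var x \<in> I"
  shows "f \<in> saturation I"
proof -
  have sub: "ring_module.subspace {g. f * g \<in> I}"
  proof (rule ring_module.subspaceI)
    show "c * x \<in> {g. f * g \<in> I}" if "x \<in> {g. f * g \<in> I}" for c x
    proof -
      have "f * x \<in> ideal_generated G"
        using that assms(1) by simp
      then have "c * (f * x) \<in> ideal_generated G"
        by (rule ring_module.span_scale)
      then show ?thesis
        unfolding mem_Collect_eq assms(1) by (subst mult.left_commute)
    qed
    show "x + y \<in> {g. f * g \<in> I}" if "x \<in> {g. f * g \<in> I}" "y \<in> {g. f * g \<in> I}" for x y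
      using that ring_module.span_add[of "f * x" G "f * y"] by (simp add: assms(1) distrib_left)
  qed (simp add: assms(1) ring_module.span_zero)
  have 1: "ideal_generated (range var) \<subseteq> {g. f * g \<in> I}"
    using assms(2) by (intro ring_module.span_minimal sub) auto
  \<comment> \<open>The first power unfolds to the product of the maximal ideal with the unit ideal
    \<open>UNIV\<close>, so multiples of its elements have to be covered too.\<close>
  have "{a * b |a b. a \<in> ideal_generated (range var) \<and> b \<in> UNIV} \<subseteq> {g. f * g \<in> I}"
  proof clarify
    fix a b assume "a \<in> ideal_generated (range (var :: 'x \<Rightarrow> ('x, 'k) mpoly))"
    then have "b * a \<in> {g. f * g \<in> I}"
      using 1 ring_module.subspace_scale[OF sub] by blast
    then show "f * (a * b) \<in> I"
      unfolding mem_Collect_eq by (subst mult.commute[of a b])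
  qed
  then have "ideal_power (ideal_generated (range var)) 1 \<subseteq> {g. f * g \<in> I}"
    unfolding One_nat_def ideal_power.simps ideal_prod_def
    by (intro ring_module.span_minimal sub)
  then have "f \<in> ideal_quotient I (ideal_power (ideal_generated (range var)) 1)"
    by (auto simp: ideal_quotient_def)
  then show ?thesis
    unfolding saturation_def by (intro UN_I[of 1]) auto
qed

section \<open>Partitions of sets of exponents into cones\<close>

text \<open>The exponents of the monomials in \<open>stanley_space u Z\<close>.\<close>

definition cone :: "('x \<Rightarrow>\<^sub>0 nat) \<Rightarrow> 'x set \<Rightarrow> ('x \<Rightarrow>\<^sub>0 nat) set" where
  "cone u Z = {u + w | w. Poly_Mapping.keys w \<subseteq> Z}"

lemma cone_iff:
  "m \<in> cone u Z \<longleftrightarrow>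
     (\<forall>x. Poly_Mapping.lookup u x \<le> Poly_Mapping.lookup m x \<and>
       (x \<notin> Z \<longrightarrow> Poly_Mapping.lookup m x = Poly_Mapping.lookup u x))"
proof
  assume "m \<in> cone u Z"
  then show "\<forall>x. Poly_Mapping.lookup u x \<le> Poly_Mapping.lookup m x \<and>
       (x \<notin> Z \<longrightarrow> Poly_Mapping.lookup m x = Poly_Mapping.lookup u x)"
    by (auto simp: cone_def lookup_add in_keys_iff)
next
  assume *: "\<forall>x. Poly_Mapping.lookup u x \<le> Poly_Mapping.lookup m x \<and>
       (x \<notin> Z \<longrightarrow> Poly_Mapping.lookup m x = Poly_Mapping.lookup u x)"
  \<comment> \<open>Subtraction of exponents is truncated, so this equation rests on
    \<open>u\<close> lying below \<open>m\<close> in every coordinate.\<close>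
  then have "m = u + (m - u)"
    by (intro poly_mapping_eqI) (simp add: lookup_add lookup_minus)
  moreover have "Poly_Mapping.keys (m - u) \<subseteq> Z"
    using * by (auto simp: in_keys_iff lookup_minus)
  ultimately show "m \<in> cone u Z"
    by (auto simp: cone_def)
qed

lemma stanley_space_eq:
  "(stanley_space u Z :: ('x, 'k::field) mpoly set) = {p. Poly_Mapping.keys p \<subseteq> cone u Z}"
proof -
  have "{monom u * monom w | w. Poly_Mapping.keys w \<subseteq> Z} = (monom ` cone u Z :: ('x, 'k) mpoly set)"
    by (auto simp: cone_def monom_def mult_single)
  then show ?thesis
    by (simp add: stanley_space_def span_monom)
qed

text \<open>The combinatorial form of a Stanley decomposition of depth at least \<open>d\<close>.
  The family is a set and may be empty, so that pieces can be glued without checking that they are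
  nonempty.\<close>

definition cone_partition :: "nat \<Rightarrow> ('x \<Rightarrow>\<^sub>0 nat) set \<Rightarrow> bool" where
  "cone_partition d W \<longleftrightarrow> (\<exists>F. finite F \<and> disjoint_family_on (\<lambda>(u, Z). cone u Z) F \<and>
     W = (\<Union>(u, Z)\<in>F. cone u Z) \<and> (\<forall>(u, Z)\<in>F. d \<le> card Z))"

section \<open>Gluing cone partitions of disjoint sets\<close>

lemma cone_partition_empty: "cone_partition d {}"
  unfolding cone_partition_def by (intro exI[of _ "{}"]) (auto simp: disjoint_family_on_def)

lemma cone_partition_cone: "d \<le> card Z \<Longrightarrow> cone_partition d (cone u Z)"
  unfolding cone_partition_def by (intro exI[of _ "{(u, Z)}"]) (auto simp: disjoint_family_on_def)

lemma cone_partition_Un: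
  assumes "cone_partition d V" "cone_partition d W" "V \<inter> W = {}"
  shows "cone_partition d (V \<union> W)"
proof -
  obtain F where F: "finite F" "disjoint_family_on (\<lambda>(u, Z). cone u Z) F"
    "V = (\<Union>(u, Z)\<in>F. cone u Z)" "\<forall>(u, Z)\<in>F. d \<le> card Z"
    using assms(1) unfolding cone_partition_def by blast
  obtain G where G: "finite G" "disjoint_family_on (\<lambda>(u, Z). cone u Z) G"
    "W = (\<Union>(u, Z)\<in>G. cone u Z)" "\<forall>(u, Z)\<in>G. d \<le> card Z"
    using assms(2) unfolding cone_partition_def by blast
  have "disjoint_family_on (\<lambda>(u, Z). cone u Z) (F \<union> G)"
    unfolding disjoint_family_on_def
  proof (intro ballI impI)
    fix s t assume st: "s \<in> F \<union> G" "t \<in> F \<union> G" "s \<noteq> t"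
    have FV: "(case s of (u, Z) \<Rightarrow> cone u Z) \<subseteq> V" if "s \<in> F" for s
      unfolding F(3) using that by blast
    have GW: "(case s of (u, Z) \<Rightarrow> cone u Z) \<subseteq> W" if "s \<in> G" for s
      unfolding G(3) using that by blast
    from st(1,2) consider "s \<in> F" "t \<in> F" | "s \<in> G" "t \<in> G" | "s \<in> F" "t \<in> G" | "s \<in> G" "t \<in> F"
      by blast
    then show "(case s of (u, Z) \<Rightarrow> cone u Z) \<inter> (case t of (u, Z) \<Rightarrow> cone u Z) = {}"
    proof cases
      case 1
      then show ?thesis using F(2) st(3) unfolding disjoint_family_on_def by blast
    next
      case 2
      then show ?thesis using G(2) st(3) unfolding disjoint_family_on_def by blast
    next
      case 3
      then show ?thesis using FV GW assms(3) by blast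
    next
      case 4
      then show ?thesis using FV GW assms(3) by blast
    qed
  qed
  then show ?thesis
    unfolding cone_partition_def using F G by (intro exI[of _ "F \<union> G"]) auto
qed

lemma cone_partition_UN:
  assumes "finite J" "disjoint_family_on W J" "\<And>i. i \<in> J \<Longrightarrow> cone_partition d (W i)"
  shows "cone_partition d (\<Union>i\<in>J. W i)"
  using assms
proof (induction J)
  case empty
  then show ?case by (simp add: cone_partition_empty)
next
  case (insert j J)
  then have "cone_partition d (\<Union>i\<in>J. W i)"
    by (auto simp: disjoint_family_on_def)
  moreover have "W j \<inter> (\<Union>i\<in>J. W i) = {}"
    using insert by (fastforce simp: disjoint_family_on_def)
  ultimately show ?case
    using insert by (auto intro: cone_partition_Un)
qed

text \<open>Existence: the support of a polynomial splits along the disjoint cones. Uniqueness: at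
  an exponent of \<open>C i\<close> only the \<open>i\<close>-th summand can have a nonzero
  coefficient, so the sum determines each summand. Nonemptiness of \<open>E\<close> makes the list
  nonempty.\<close>

lemma cone_partition_stanley_decomposition:
  assumes "cone_partition d E" "E \<noteq> {}"
  obtains D where "stanley_decomposition {p :: ('x, 'k::field) mpoly. Poly_Mapping.keys p \<subseteq> E} D"
    and "d \<le> decomp_sdepth D"
proof -
  obtain F where F: "finite F" "disjoint_family_on (\<lambda>(u, Z). cone u Z) F"
    "E = (\<Union>(u, Z)\<in>F. cone u Z)" "\<forall>(u, Z)\<in>F. d \<le> card Z"
    using assms(1) unfolding cone_partition_def by blast
  obtain D where D: "set D = F" "distinct D"
    using finite_distinct_list[OF F(1)] by blast
  define C where "C i = cone (fst (D ! i)) (snd (D ! i))" for i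
  have disj: "C i \<inter> C j = {}" if "i < length D" "j < length D" "i \<noteq> j" for i j
  proof -
    have "D ! i \<noteq> D ! j" "D ! i \<in> F" "D ! j \<in> F"
      using that D by (auto simp: nth_eq_iff_index_eq)
    then show ?thesis
      using F(2) by (auto simp: C_def disjoint_family_on_def split_def)
  qed
  have E: "E = (\<Union>i<length D. C i)"
    unfolding F(3) D(1)[symmetric] C_def by (force simp: in_set_conv_nth)
  have "D \<noteq> []"
    using assms(2) F(3) D(1) by auto
  have lookup_sum_eq: "Poly_Mapping.lookup (\<Sum>i<length D. f i) m = Poly_Mapping.lookup (f i) m"
    if "\<forall>i<length D. f i \<in> {p. Poly_Mapping.keys p \<subseteq> C i}" "i < length D" "m \<in> C i"
    for f :: "nat \<Rightarrow> ('x, 'k) mpoly" and i m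
  proof -
    have "Poly_Mapping.lookup (f j) m = 0" if "j < length D" "j \<noteq> i" for j
      using that \<open>i < length D\<close> \<open>m \<in> C i\<close> disj[of i j]
        \<open>\<forall>i<length D. f i \<in> {p. Poly_Mapping.keys p \<subseteq> C i}\<close>
      by (auto simp: in_keys_iff subset_iff)
    then have "(\<Sum>j<length D. Poly_Mapping.lookup (f j) m) = (\<Sum>j\<in>{i}. Poly_Mapping.lookup (f j) m)"
      using \<open>i < length D\<close> by (intro sum.mono_neutral_right) auto
    then show ?thesis by (simp add: lookup_sum)
  qed
  have "{p :: ('x, 'k) mpoly. Poly_Mapping.keys p \<subseteq> E}
      = {\<Sum>i<length D. f i | f. \<forall>i<length D. f i \<in> {p. Poly_Mapping.keys p \<subseteq> C i}}"
  proof (intro equalityI subsetI)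
    fix p :: "('x, 'k) mpoly" assume p: "p \<in> {p. Poly_Mapping.keys p \<subseteq> E}"
    \<comment> \<open>The part of \<open>p\<close> supported on the \<open>i\<close>-th
      cone.\<close>
    define f where "f i = (\<Sum>k\<in>Poly_Mapping.keys p \<inter> C i.
      Poly_Mapping.single k (Poly_Mapping.lookup p k))" for i
    have f: "f i \<in> {p. Poly_Mapping.keys p \<subseteq> C i}" for i
      unfolding f_def
      using keys_sum[of "\<lambda>k. Poly_Mapping.single k (Poly_Mapping.lookup p k)" "Poly_Mapping.keys p \<inter> C i"]
      by (auto split: if_splits)
    have "(\<Union>i<length D. Poly_Mapping.keys p \<inter> C i) = Poly_Mapping.keys p"
      using p E by auto
    then have "(\<Sum>i<length D. f i) = p"
      unfolding f_def
      using disj sum.UNION_disjoint[of "{..<length D}" "\<lambda>i. Poly_Mapping.keys p \<inter> C i"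
        "\<lambda>k. Poly_Mapping.single k (Poly_Mapping.lookup p k)", symmetric]
      by (auto simp: sum_lookup_single)
    then show "p \<in> {\<Sum>i<length D. f i | f. \<forall>i<length D. f i \<in> {p. Poly_Mapping.keys p \<subseteq> C i}}"
      using f by blast
  next
    fix p :: "('x, 'k) mpoly"
    assume "p \<in> {\<Sum>i<length D. f i | f. \<forall>i<length D. f i \<in> {p. Poly_Mapping.keys p \<subseteq> C i}}"
    then obtain f where "p = (\<Sum>i<length D. f i)" "\<forall>i<length D. Poly_Mapping.keys (f i) \<subseteq> C i"
      by blast
    then have "Poly_Mapping.keys p \<subseteq> (\<Union>i<length D. C i)"
      using keys_sum[of f "{..<length D}"] by (force simp: subset_iff)
    then show "p \<in> {p. Poly_Mapping.keys p \<subseteq> E}"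
      by (simp add: E)
  qed
  moreover have "f i = g i"
    if f: "\<forall>i<length D. f i \<in> {p. Poly_Mapping.keys p \<subseteq> C i}"
      and g: "\<forall>i<length D. g i \<in> {p. Poly_Mapping.keys p \<subseteq> C i}"
      and eq: "(\<Sum>i<length D. f i) = (\<Sum>i<length D. g i)" and i: "i < length D"
    for f g :: "nat \<Rightarrow> ('x, 'k) mpoly" and i
  proof (rule poly_mapping_eqI)
    fix m
    show "Poly_Mapping.lookup (f i) m = Poly_Mapping.lookup (g i) m"
    proof (cases "m \<in> C i")
      case True
      then show ?thesis
        using lookup_sum_eq[OF f i] lookup_sum_eq[OF g i] eq by simp
    next
      case False
      then have "m \<notin> Poly_Mapping.keys (f i)" "m \<notin> Poly_Mapping.keys (g i)"
        using f g i by auto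
      then show ?thesis by (simp add: in_keys_iff)
    qed
  qed
  ultimately have "internal_direct_sum {p :: ('x, 'k) mpoly. Poly_Mapping.keys p \<subseteq> E}
      (length D) (\<lambda>i. stanley_space (fst (D ! i)) (snd (D ! i)))"
    unfolding internal_direct_sum_def stanley_space_eq C_def by blast
  then have "stanley_decomposition {p :: ('x, 'k) mpoly. Poly_Mapping.keys p \<subseteq> E} D"
    using \<open>D \<noteq> []\<close> by (simp add: stanley_decomposition_def)
  moreover have "d \<le> decomp_sdepth D"
    using F(4) D(1) \<open>D \<noteq> []\<close> by (auto simp: decomp_sdepth_def Min_ge_iff)
  ultimately show thesis
    using that by blast
qed

section \<open>Dickson's lemma\<close>

text \<open>Every sequence has a monotone subsequence. If it is decreasing, it attains its least
  value and stays there, so a shift makes it constant.\<close>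

lemma nat_seq_incseq_subseq:
  fixes s :: "nat \<Rightarrow> nat"
  obtains r where "strict_mono r" "incseq (s \<circ> r)"
proof -
  obtain r where r: "strict_mono r" "monoseq (\<lambda>n. s (r n))"
    using seq_monosub by blast
  show thesis
  proof (cases "incseq (\<lambda>n. s (r n))")
    case True
    then show ?thesis using that r by (simp add: o_def)
  next
    case False
    then have dec: "decseq (\<lambda>n. s (r n))"
      using r by (simp add: monoseq_iff)
    define L where "L = (LEAST v. v \<in> range (\<lambda>n. s (r n)))"
    have "L \<in> range (\<lambda>n. s (r n))"
      unfolding L_def by (rule LeastI) blast
    then obtain n0 where n0: "L = s (r n0)"
      by blast
    have "s (r (n + n0)) = L" for n
      using decseqD[OF dec, of n0 "n + n0"] n0 Least_le[of "\<lambda>v. v \<in> range (\<lambda>n. s (r n))" "s (r (n + n0))"]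
      unfolding L_def[symmetric] by auto
    then have "incseq (s \<circ> (\<lambda>n. r (n + n0)))"
      by (simp add: incseq_def)
    moreover have "strict_mono (\<lambda>n. r (n + n0))"
      using r by (simp add: strict_mono_def)
    ultimately show ?thesis using that by blast
  qed
qed

text \<open>The coordinates are treated one at a time: passing to a further subsequence preserves
  the monotonicity already achieved.\<close>

lemma finite_coordinates_incseq_subseq:
  fixes s :: "nat \<Rightarrow> 'x \<Rightarrow> nat"
  assumes "finite X"
  shows "\<exists>r. strict_mono r \<and> (\<forall>x\<in>X. incseq (\<lambda>n. s (r n) x))"
  using assms
proof (induction X)
  case empty
  show ?case using strict_mono_id by blast
next
  case (insert y X)
  then obtain r where r: "strict_mono r" "\<forall>x\<in>X. incseq (\<lambda>n. s (r n) x)"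
    by blast
  obtain q where q: "strict_mono q" "incseq ((\<lambda>n. s (r n) y) \<circ> q)"
    using nat_seq_incseq_subseq by blast
  have "strict_mono (r \<circ> q)"
    using r q by (simp add: strict_mono_o)
  moreover have "incseq (\<lambda>n. s ((r \<circ> q) n) x)" if "x \<in> insert y X" for x
  proof (cases "x = y")
    case True
    then show ?thesis using q by (simp add: o_def)
  next
    case False
    then have "incseq (\<lambda>n. s (r n) x)"
      using that r by blast
    then show ?thesis
      using strict_mono_mono[OF q(1)] by (auto simp: incseq_def mono_def)
  qed
  ultimately show ?case by blast
qed

text \<open>Dickson's lemma in the form used below: the set \<open>B\<close> of minimal elements is
  finite, every element of \<open>E\<close> lies above one of them, and \<open>N\<close> bounds all
  their coordinates.\<close>

lemma exponents_dominate_bounded: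
  fixes E :: "('x::finite \<Rightarrow>\<^sub>0 nat) set"
  obtains N where "\<And>m. m \<in> E \<Longrightarrow> \<exists>u\<in>E. \<forall>x. Poly_Mapping.lookup u x \<le> Poly_Mapping.lookup m x
    \<and> Poly_Mapping.lookup u x \<le> N"
proof -
  define le where "le u m \<longleftrightarrow> (\<forall>x. Poly_Mapping.lookup u x \<le> Poly_Mapping.lookup m x)"
    for u m :: "'x \<Rightarrow>\<^sub>0 nat"
  have anti: "u = m" if "le u m" "le m u" for u m
    using that unfolding le_def by (intro poly_mapping_eqI) (meson antisym)
  define B where "B = {u \<in> E. \<forall>v\<in>E. le v u \<longrightarrow> v = u}"
  have "finite B"
  proof (rule ccontr)
    assume "infinite B"
    \<comment> \<open>An infinite \<open>B\<close> contains an injective sequence. Along a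
      subsequence increasing in every coordinate, the first two terms are comparable, hence equal by
      minimality, against injectivity.\<close>
    then obtain s :: "nat \<Rightarrow> 'x \<Rightarrow>\<^sub>0 nat" where s: "inj s" "range s \<subseteq> B"
      using infinite_countable_subset by blast
    obtain r where r: "strict_mono r" "\<forall>x\<in>UNIV. incseq (\<lambda>n. Poly_Mapping.lookup (s (r n)) x)"
      using finite_coordinates_incseq_subseq[of UNIV "\<lambda>n. Poly_Mapping.lookup (s n)"] by auto
    have "le (s (r 0)) (s (r 1))"
      using r(2) by (auto simp: le_def incseq_def)
    moreover have "s (r 0) \<in> B" "s (r 1) \<in> B"
      using s(2) by auto
    ultimately have "s (r 0) = s (r 1)"
      by (auto simp: B_def)
    then have "r 0 = r 1"
      using s(1) by (simp add: inj_eq)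
    then show False
      using strict_monoD[OF r(1), of 0 1] by simp
  qed
  have dom: "\<exists>u\<in>B. le u m" if "m \<in> E" for m
    using that
  \<comment> \<open>Descent on the total degree: a non-minimal \<open>m\<close> has a different
    element of \<open>E\<close> below it, whose degree is strictly smaller.\<close>
  proof (induction m rule: measure_induct_rule[of "\<lambda>m. \<Sum>x\<in>UNIV. Poly_Mapping.lookup m x"])
    case (less m)
    show ?case
    proof (cases "m \<in> B")
      case True
      then show ?thesis by (auto simp: le_def)
    next
      case False
      then obtain v where v: "v \<in> E" "le v m" "v \<noteq> m"
        using less.prems by (auto simp: B_def)
      then obtain x where "\<not> Poly_Mapping.lookup m x \<le> Poly_Mapping.lookup v x"
        using anti unfolding le_def by blast
      then have "(\<Sum>x\<in>UNIV. Poly_Mapping.lookup v x) < (\<Sum>x\<in>UNIV. Poly_Mapping.lookup m x)"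
        using v(2) unfolding le_def by (intro sum_strict_mono_ex1) (auto intro!: exI[of _ x])
      then obtain u where "u \<in> B" "le u v"
        using less.IH v(1) by blast
      then show ?thesis
        using v(2) unfolding le_def by (meson order_trans)
    qed
  qed
  \<comment> \<open>The inserted 0 keeps \<open>Max\<close> meaningful when \<open>B\<close> is
    empty.\<close>
  define N where "N = Max (insert 0 ((\<lambda>(u, x). Poly_Mapping.lookup u x) ` (B \<times> UNIV)))"
  have "Poly_Mapping.lookup u x \<le> N" if "u \<in> B" for u x
    unfolding N_def using that \<open>finite B\<close> by (intro Max_ge) auto
  then have "\<exists>u\<in>E. \<forall>x. Poly_Mapping.lookup u x \<le> Poly_Mapping.lookup m x
    \<and> Poly_Mapping.lookup u x \<le> N" if "m \<in> E" for m
    using dom[OF that] unfolding le_def B_def by blast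
  then show thesis
    using that by blast
qed

section \<open>Three variables\<close>

text \<open>In the numeral type \<open>3\<close> the index 3 is the same element as 0; the indices
  1, 2, 3 match \<open>exhaust_3\<close> and \<open>forall_3\<close>.\<close>

definition exponent3 :: "nat \<Rightarrow> nat \<Rightarrow> nat \<Rightarrow> (3 \<Rightarrow>\<^sub>0 nat)" where
  "exponent3 a b c = Poly_Mapping.single 1 a + Poly_Mapping.single 2 b + Poly_Mapping.single 3 c"

lemma lookup_exponent3 [simp]:
  "Poly_Mapping.lookup (exponent3 a b c) 1 = a"
  "Poly_Mapping.lookup (exponent3 a b c) 2 = b"
  "Poly_Mapping.lookup (exponent3 a b c) 3 = c"
  by (simp_all add: exponent3_def lookup_add lookup_single)

lemma exponent3_lookup [simp]:
  "exponent3 (Poly_Mapping.lookup m 1) (Poly_Mapping.lookup m 2) (Poly_Mapping.lookup m 3) = m"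
proof (rule poly_mapping_eqI)
  fix x :: 3
  show "Poly_Mapping.lookup (exponent3 (Poly_Mapping.lookup m 1) (Poly_Mapping.lookup m 2)
      (Poly_Mapping.lookup m 3)) x = Poly_Mapping.lookup m x"
    using exhaust_3[of x] by (elim disjE) (simp_all only: lookup_exponent3)
qed

section \<open>Upright pieces over rays and quadrants of the plane\<close>

lemma upward_closed_nat_eq_atLeast:
  fixes P :: "nat \<Rightarrow> bool"
  assumes "\<And>b. P b \<Longrightarrow> P (Suc b)" and "\<exists>b. P b"
  shows "\<exists>n. \<forall>b. P b \<longleftrightarrow> n \<le> b"
proof -
  have "P b" if "(LEAST b. P b) \<le> b" for b
    using that by (induction rule: dec_induct) (use assms in \<open>auto intro: LeastI_ex\<close>)
  then have "P b \<longleftrightarrow> (LEAST b. P b) \<le> b" for b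
    using Least_le[of P] by blast
  then show ?thesis by blast
qed

text \<open>An upward closed \<open>P\<close> is empty or a ray, and a ray times the vertical
  direction is one cone with free variables 2 and 3.\<close>

lemma cone_partition_column:
  assumes "\<And>b. P b \<Longrightarrow> P (Suc b)"
  shows "cone_partition 2 {m :: 3 \<Rightarrow>\<^sub>0 nat.
    Poly_Mapping.lookup m 1 = a \<and> P (Poly_Mapping.lookup m 2) \<and> c \<le> Poly_Mapping.lookup m 3}"
proof (cases "\<exists>b. P b")
  case True
  then obtain n where n: "\<forall>b. P b \<longleftrightarrow> n \<le> b"
    using upward_closed_nat_eq_atLeast[of P, OF assms] by metis
  have "{m. Poly_Mapping.lookup m 1 = a \<and> P (Poly_Mapping.lookup m 2) \<and> c \<le> Poly_Mapping.lookup m 3}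
      = cone (exponent3 a n c) {2, 3}"
    by (auto simp: n cone_iff forall_3)
  then show ?thesis
    by (simp add: cone_partition_cone)
qed (simp add: cone_partition_empty)

lemma cone_partition_row:
  assumes "\<And>a. P a \<Longrightarrow> P (Suc a)"
  shows "cone_partition 2 {m :: 3 \<Rightarrow>\<^sub>0 nat.
    P (Poly_Mapping.lookup m 1) \<and> Poly_Mapping.lookup m 2 = b \<and> c \<le> Poly_Mapping.lookup m 3}"
proof (cases "\<exists>b. P b")
  case True
  then obtain n where n: "\<forall>b. P b \<longleftrightarrow> n \<le> b"
    using upward_closed_nat_eq_atLeast[of P, OF assms] by metis
  have "{m. P (Poly_Mapping.lookup m 1) \<and> Poly_Mapping.lookup m 2 = b \<and> c \<le> Poly_Mapping.lookup m 3}
      = cone (exponent3 n b c) {1, 3}"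
    by (auto simp: n cone_iff forall_3)
  then show ?thesis
    by (simp add: cone_partition_cone)
qed (simp add: cone_partition_empty)

lemma cone_partition_quadrant:
  assumes "\<And>b. P b \<Longrightarrow> P (Suc b)"
  shows "cone_partition 2 {m :: 3 \<Rightarrow>\<^sub>0 nat.
    a \<le> Poly_Mapping.lookup m 1 \<and> P (Poly_Mapping.lookup m 2) \<and> c \<le> Poly_Mapping.lookup m 3}"
proof (cases "\<exists>b. P b")
  case True
  then obtain n where n: "\<forall>b. P b \<longleftrightarrow> n \<le> b"
    using upward_closed_nat_eq_atLeast[of P, OF assms] by metis
  have "{m. a \<le> Poly_Mapping.lookup m 1 \<and> P (Poly_Mapping.lookup m 2) \<and> c \<le> Poly_Mapping.lookup m 3}
      = cone (exponent3 a n c) UNIV"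
    by (auto simp: n cone_iff forall_3)
  then show ?thesis
    by (simp add: cone_partition_cone)
qed (simp add: cone_partition_empty)

lemma cone_partition_columns:
  assumes "\<And>a b. a < n \<Longrightarrow> P a b \<Longrightarrow> P a (Suc b)"
  shows "cone_partition 2 {m :: 3 \<Rightarrow>\<^sub>0 nat. Poly_Mapping.lookup m 1 < n \<and>
    P (Poly_Mapping.lookup m 1) (Poly_Mapping.lookup m 2) \<and> c \<le> Poly_Mapping.lookup m 3}"
proof -
  have "cone_partition 2 (\<Union>a<n. {m :: 3 \<Rightarrow>\<^sub>0 nat.
      Poly_Mapping.lookup m 1 = a \<and> P a (Poly_Mapping.lookup m 2) \<and> c \<le> Poly_Mapping.lookup m 3})"
    using assms by (intro cone_partition_UN cone_partition_column) (auto simp: disjoint_family_on_def)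
  also have "(\<Union>a<n. {m :: 3 \<Rightarrow>\<^sub>0 nat.
      Poly_Mapping.lookup m 1 = a \<and> P a (Poly_Mapping.lookup m 2) \<and> c \<le> Poly_Mapping.lookup m 3})
    = {m. Poly_Mapping.lookup m 1 < n \<and>
        P (Poly_Mapping.lookup m 1) (Poly_Mapping.lookup m 2) \<and> c \<le> Poly_Mapping.lookup m 3}"
    by auto
  finally show ?thesis .
qed

lemma cone_partition_rows:
  assumes "\<And>a b. b < n \<Longrightarrow> P a b \<Longrightarrow> P (Suc a) b"
  shows "cone_partition 2 {m :: 3 \<Rightarrow>\<^sub>0 nat. Poly_Mapping.lookup m 2 < n \<and>
    P (Poly_Mapping.lookup m 1) (Poly_Mapping.lookup m 2) \<and> c \<le> Poly_Mapping.lookup m 3}"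
proof -
  have "cone_partition 2 (\<Union>b<n. {m :: 3 \<Rightarrow>\<^sub>0 nat.
      P (Poly_Mapping.lookup m 1) b \<and> Poly_Mapping.lookup m 2 = b \<and> c \<le> Poly_Mapping.lookup m 3})"
    using assms by (intro cone_partition_UN cone_partition_row) (auto simp: disjoint_family_on_def)
  also have "(\<Union>b<n. {m :: 3 \<Rightarrow>\<^sub>0 nat.
      P (Poly_Mapping.lookup m 1) b \<and> Poly_Mapping.lookup m 2 = b \<and> c \<le> Poly_Mapping.lookup m 3})
    = {m. Poly_Mapping.lookup m 2 < n \<and>
        P (Poly_Mapping.lookup m 1) (Poly_Mapping.lookup m 2) \<and> c \<le> Poly_Mapping.lookup m 3}"
    by auto
  finally show ?thesis .
qed

text \<open>Here \<open>V\<close> plays the current slice and \<open>U\<close> the one below it. If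
  \<open>U\<close> is empty, \<open>V\<close> consists of finitely many columns and a quadrant.
  Otherwise let \<open>\<alpha>\<close> be the first column meeting \<open>U\<close>. The columns
  before it avoid \<open>U\<close> and are rays in \<open>V\<close>. From \<open>\<alpha>\<close>
  on, the difference occupies finitely many rows, each a ray to the right by
  \<open>socle\<close>.\<close>

lemma cone_partition_layer:
  fixes U V :: "nat \<Rightarrow> nat \<Rightarrow> bool"
  assumes V: "\<And>a b. V a b \<Longrightarrow> V (Suc a) b" "\<And>a b. V a b \<Longrightarrow> V a (Suc b)"
    and U: "\<And>a b. U a b \<Longrightarrow> U (Suc a) b" "\<And>a b. U a b \<Longrightarrow> U a (Suc b)"
    and socle: "\<And>a b. V a b \<Longrightarrow> U (Suc a) b \<Longrightarrow> U a (Suc b) \<Longrightarrow> U a b"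
    and stable: "\<And>a b. N \<le> a \<Longrightarrow> V a b \<Longrightarrow> V N b"
  shows "cone_partition 2 {m :: 3 \<Rightarrow>\<^sub>0 nat.
    (V (Poly_Mapping.lookup m 1) (Poly_Mapping.lookup m 2) \<and>
      \<not> U (Poly_Mapping.lookup m 1) (Poly_Mapping.lookup m 2)) \<and> c \<le> Poly_Mapping.lookup m 3}"
    (is "cone_partition 2 ?W")
proof (cases "\<exists>a b. U a b")
  case False
  have V_mono: "V a b" if "a' \<le> a" "V a' b" for a a' b
    using that by (induction rule: dec_induct) (auto intro: V)
  \<comment> \<open>From \<open>N\<close> on all columns of \<open>V\<close> coincide:
    \<open>stable\<close> moves a point left to column \<open>N\<close>, and \<open>V_mono\<close>
    moves it back. Together they form a quadrant.\<close>
  have "?W = {m. Poly_Mapping.lookup m 1 < N \<and>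
        V (Poly_Mapping.lookup m 1) (Poly_Mapping.lookup m 2) \<and> c \<le> Poly_Mapping.lookup m 3} \<union>
      {m. N \<le> Poly_Mapping.lookup m 1 \<and> V N (Poly_Mapping.lookup m 2) \<and> c \<le> Poly_Mapping.lookup m 3}"
    using False stable V_mono by (auto simp: not_less)
  then show ?thesis
    by (simp only:) (intro cone_partition_Un cone_partition_columns cone_partition_quadrant, auto intro: V)
next
  case True
  define \<alpha> where "\<alpha> = (LEAST a. \<exists>b. U a b)"
  \<comment> \<open>Since \<open>U\<close> is upward closed, it contains the whole quadrant with
    corner \<open>(\<alpha>, \<beta>)\<close>.\<close>
  obtain \<beta> where \<beta>: "U \<alpha> \<beta>"
    unfolding \<alpha>_def using LeastI_ex[OF True] by blast
  have left: "\<not> U a b" if "a < \<alpha>" for a b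
    using that not_less_Least unfolding \<alpha>_def by blast
  have U1: "U a b" if "a' \<le> a" "U a' b" for a a' b
    using that by (induction rule: dec_induct) (auto intro: U)
  have U2: "U a b" if "b' \<le> b" "U a b'" for a b b'
    using that by (induction rule: dec_induct) (auto intro: U)
  have V2: "V a b" if "b' \<le> b" "V a b'" for a b b'
    using that by (induction rule: dec_induct) (auto intro: V)
  have right: "\<not> U (Suc a) b" if "\<alpha> \<le> a" "V a b" "\<not> U a b" for a b
  proof
    assume "U (Suc a) b"
    \<comment> \<open>The column over \<open>(a, b)\<close> enters \<open>U\<close>, and its last point outside \<open>U\<close> violates \<open>socle\<close>.\<close>
    define j where "j = (LEAST j. U a (b + j))"
    \<comment> \<open>The witness that makes the \<open>LEAST\<close> in \<open>j\<close>
      meaningful: column \<open>a\<close> lies at or beyond \<open>\<alpha>\<close>, so it contains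
      the point at height \<open>\<beta>\<close> and all points above it.\<close>
    have "U a (b + \<beta>)"
      using U1[OF \<open>\<alpha> \<le> a\<close> \<beta>] by (rule U2[rotated]) simp
    then have j: "U a (b + j)"
      unfolding j_def by (rule LeastI)
    with \<open>\<not> U a b\<close> obtain i where i: "j = Suc i"
      by (cases j) auto
    have "\<not> U a (b + i)"
      using not_less_Least[of i "\<lambda>j. U a (b + j)"] i unfolding j_def[symmetric] by simp
    moreover have "U (Suc a) (b + i)"
      using \<open>U (Suc a) b\<close> by (rule U2[rotated]) simp
    moreover have "V a (b + i)"
      using \<open>V a b\<close> by (rule V2[rotated]) simp
    ultimately show False
      using socle j i by auto
  qed
  \<comment> \<open>In columns from \<open>\<alpha>\<close> on, a point outside \<open>U\<close>
    must have second coordinate below \<open>\<beta>\<close>, which leaves finitely many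
    rows.\<close>
  have "?W = {m. Poly_Mapping.lookup m 1 < \<alpha> \<and>
        V (Poly_Mapping.lookup m 1) (Poly_Mapping.lookup m 2) \<and> c \<le> Poly_Mapping.lookup m 3} \<union>
      {m. Poly_Mapping.lookup m 2 < \<beta> \<and> (\<alpha> \<le> Poly_Mapping.lookup m 1 \<and>
        V (Poly_Mapping.lookup m 1) (Poly_Mapping.lookup m 2) \<and>
        \<not> U (Poly_Mapping.lookup m 1) (Poly_Mapping.lookup m 2)) \<and> c \<le> Poly_Mapping.lookup m 3}"
    using left U1 U2 \<beta> by (auto simp: not_less) (meson not_less)+
  moreover have "cone_partition 2 {m :: 3 \<Rightarrow>\<^sub>0 nat. Poly_Mapping.lookup m 1 < \<alpha> \<and>
        V (Poly_Mapping.lookup m 1) (Poly_Mapping.lookup m 2) \<and> c \<le> Poly_Mapping.lookup m 3}"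
    using V(2) by (rule cone_partition_columns)
  \<comment> \<open>By \<open>right\<close>, a step to the right never enters \<open>U\<close> from
    this set, so each of its rows is upward closed.\<close>
  moreover have "cone_partition 2 {m :: 3 \<Rightarrow>\<^sub>0 nat. Poly_Mapping.lookup m 2 < \<beta> \<and>
        (\<alpha> \<le> Poly_Mapping.lookup m 1 \<and>
        V (Poly_Mapping.lookup m 1) (Poly_Mapping.lookup m 2) \<and>
        \<not> U (Poly_Mapping.lookup m 1) (Poly_Mapping.lookup m 2)) \<and> c \<le> Poly_Mapping.lookup m 3}"
    using right V(1)
    by (intro cone_partition_rows[where P = "\<lambda>a b. \<alpha> \<le> a \<and> V a b \<and> \<not> U a b"]) auto
  ultimately show ?thesis
    by (simp only:) (intro cone_partition_Un, auto)
qed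

section \<open>Slicing a saturated set of exponents by height\<close>

lemma cone_partition_saturated:
  fixes E :: "(3 \<Rightarrow>\<^sub>0 nat) set"
  assumes up: "\<And>m w. m \<in> E \<Longrightarrow> m + w \<in> E"
    and sat: "\<And>m. (\<And>x. m + Poly_Mapping.single x 1 \<in> E) \<Longrightarrow> m \<in> E"
  shows "cone_partition 2 E"
proof -
  define M where "M c a b \<longleftrightarrow> exponent3 a b c \<in> E" for a b c
  have M_mono: "M c' a' b'" if "M c a b" "a \<le> a'" "b \<le> b'" "c \<le> c'" for a b c a' b' c'
  proof -
    have "exponent3 a' b' c' = exponent3 a b c + exponent3 (a' - a) (b' - b) (c' - c)"
      using that by (intro poly_mapping_eqI) (simp add: exponent3_def lookup_add lookup_single when_def)
    then show ?thesis
      using up that(1) by (simp add: M_def)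
  qed
  have M_socle: "M c a b" if "M (Suc c) a b" "M c (Suc a) b" "M c a (Suc b)" for a b c
  proof -
    have "exponent3 a b c + Poly_Mapping.single 1 1 = exponent3 (Suc a) b c"
      "exponent3 a b c + Poly_Mapping.single 2 1 = exponent3 a (Suc b) c"
      "exponent3 a b c + Poly_Mapping.single 3 1 = exponent3 a b (Suc c)"
      by (auto intro!: poly_mapping_eqI simp: exponent3_def lookup_add lookup_single when_def)
    then have "exponent3 a b c + Poly_Mapping.single x 1 \<in> E" for x
      using that exhaust_3[of x] by (auto simp: M_def)
    then show ?thesis
      using sat by (simp add: M_def)
  qed
  obtain N where N: "\<And>m. m \<in> E \<Longrightarrow> \<exists>u\<in>E. \<forall>x. Poly_Mapping.lookup u x \<le> Poly_Mapping.lookup m x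
    \<and> Poly_Mapping.lookup u x \<le> N"
    using exponents_dominate_bounded by blast
  \<comment> \<open>The point of \<open>E\<close> below \<open>(a, b, c)\<close> with coordinates at
    most \<open>N\<close> also lies below the point clipped at \<open>N\<close>. Hence the slices
    stop growing at height \<open>N\<close>, and within each slice the columns stop growing at
    \<open>N\<close>.\<close>
  have M_stable: "M (min c N) (min a N) (min b N)" if M: "M c a b" for a b c
  proof -
    obtain u where u: "u \<in> E" "\<forall>x. Poly_Mapping.lookup u x \<le> Poly_Mapping.lookup (exponent3 a b c) x
      \<and> Poly_Mapping.lookup u x \<le> N"
      using N[OF M[unfolded M_def]] by blast
    then have "M (Poly_Mapping.lookup u 3) (Poly_Mapping.lookup u 1) (Poly_Mapping.lookup u 2)"
      by (simp add: M_def)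
    then show ?thesis
      by (rule M_mono) (use u(2) in \<open>simp_all add: forall_3\<close>)
  qed
  \<comment> \<open>\<open>W c\<close> collects the exponents whose vertical line enters \<open>E\<close> exactly at height \<open>c\<close>.\<close>
  define V where "V c a b \<longleftrightarrow> M c a b" for c a b
  \<comment> \<open>The condition \<open>c \<noteq> 0\<close> makes the slice below the bottom
    empty; truncated subtraction alone would return slice 0 itself.\<close>
  define U where "U c a b \<longleftrightarrow> c \<noteq> 0 \<and> M (c - 1) a b" for c a b
  define W where "W c = {m :: 3 \<Rightarrow>\<^sub>0 nat.
    (V c (Poly_Mapping.lookup m 1) (Poly_Mapping.lookup m 2) \<and>
      \<not> U c (Poly_Mapping.lookup m 1) (Poly_Mapping.lookup m 2)) \<and> c \<le> Poly_Mapping.lookup m 3}" for c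
  have "cone_partition 2 (W c)" for c
    unfolding W_def
  proof (rule cone_partition_layer[where N = N])
    \<comment> \<open>The point at height \<open>c - 1\<close> has its vertical neighbour in
      \<open>V c\<close> and its planar neighbours in \<open>U c\<close>, so saturation applies to
      it.\<close>
    show "U c a b" if "V c a b" "U c (Suc a) b" "U c a (Suc b)" for a b
      using that M_socle[of "c - 1" a b] by (auto simp: U_def V_def)
    show "V c N b" if "N \<le> a" "V c a b" for a b
      using that M_stable[of c a b] by (auto simp: V_def intro: M_mono)
  qed (auto simp: U_def V_def intro: M_mono)
  moreover have "disjoint_family_on W {..N}"
  proof -
    \<comment> \<open>A point of \<open>W c\<close> has its projection in slice \<open>c\<close>,
      hence in slice \<open>d - 1\<close>, which is what \<open>W d\<close> excludes.\<close>
    have "W c \<inter> W d = {}" if "c < d" for c d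
      using that M_mono[of c _ _ _ _ "d - 1"] by (auto simp: W_def U_def V_def)
    then show ?thesis
      unfolding disjoint_family_on_def by (metis Int_commute linorder_neqE_nat)
  qed
  ultimately have "cone_partition 2 (\<Union>c\<le>N. W c)"
    by (intro cone_partition_UN) auto
  moreover have "E = (\<Union>c\<le>N. W c)"
  proof (intro equalityI subsetI)
    fix m assume "m \<in> E"
    define a b where "a = Poly_Mapping.lookup m 1" and "b = Poly_Mapping.lookup m 2"
    have m: "M (Poly_Mapping.lookup m 3) a b"
      using \<open>m \<in> E\<close> by (simp add: M_def a_def b_def)
    \<comment> \<open>The height at which the vertical line through \<open>m\<close> enters
      \<open>E\<close>; clipping \<open>m\<close> at height \<open>N\<close> shows that it is at
      most \<open>N\<close>.\<close>
    define c where "c = (LEAST c. M c a b)"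
    have c: "M c a b" "c \<le> Poly_Mapping.lookup m 3"
      unfolding c_def using m by (auto intro: LeastI Least_le)
    have "M (min (Poly_Mapping.lookup m 3) N) a b"
      using M_stable[OF m] by (rule M_mono) auto
    then have "c \<le> N"
      unfolding c_def using Least_le[of "\<lambda>c. M c a b"] by fastforce
    moreover have "\<not> U c a b"
      using not_less_Least[of "c - 1" "\<lambda>c. M c a b"] by (auto simp: U_def c_def[symmetric])
    ultimately show "m \<in> (\<Union>c\<le>N. W c)"
      using c by (auto simp: W_def V_def a_def b_def)
  next
    fix m assume "m \<in> (\<Union>c\<le>N. W c)"
    then have "M (Poly_Mapping.lookup m 3) (Poly_Mapping.lookup m 1) (Poly_Mapping.lookup m 2)"
      by (auto simp: W_def V_def intro: M_mono)
    then show "m \<in> E"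
      by (simp add: M_def)
  qed
  ultimately show ?thesis by simp
qed

section \<open>Decompositions of maximal depth\<close>

lemma principal_ideal_of_full_depth:
  fixes I :: "('x::finite, 'k::field) mpoly set"
  assumes "stanley_decomposition I D" "CARD('x) \<le> decomp_sdepth D"
  shows "principal_ideal I"
proof -
  have D: "D \<noteq> []" "internal_direct_sum I (length D) (\<lambda>i. stanley_space (fst (D ! i)) (snd (D ! i)))"
    using assms(1) by (auto simp: stanley_decomposition_def)
  have full: "snd (D ! i) = UNIV" if "i < length D" for i
  proof -
    have "D ! i \<in> set D"
      using that by simp
    then have "decomp_sdepth D \<le> card (snd (D ! i))"
      unfolding decomp_sdepth_def by (intro Min_le) (force simp: split_def)+
    then have "card (snd (D ! i)) = CARD('x)"
      using assms(2) card_mono[of UNIV "snd (D ! i)"] by simp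
    then show ?thesis
      by (simp add: card_eq_UNIV_imp_eq_UNIV)
  qed
  have "length D = 1"
  proof (rule ccontr)
    assume "length D \<noteq> 1"
    with D(1) have len: "0 < length D" "1 < length D"
      by (cases D; auto)+
    \<comment> \<open>The product of the first two generators lies in both summands, because both
      have all variables free.\<close>
    define p :: "('x, 'k) mpoly" where "p = monom (fst (D ! 0) + fst (D ! 1))"
    have p: "p \<in> stanley_space (fst (D ! i)) (snd (D ! i))" if "i < 2" for i
    proof -
      have "i = 0 \<or> i = 1" using that by auto
      then show ?thesis
        using full len by (auto simp: p_def monom_def stanley_space_eq cone_iff lookup_add)
    qed
    \<comment> \<open>Two representations of \<open>p\<close>, placing it in summand 0 or in summand
      1. Uniqueness would force \<open>p = 0\<close>.\<close>
    define f g where "f = (\<lambda>i::nat. if i = 0 then p else 0)" and "g = (\<lambda>i::nat. if i = 1 then p else 0)"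
    have "\<forall>i<length D. f i \<in> stanley_space (fst (D ! i)) (snd (D ! i))"
      "\<forall>i<length D. g i \<in> stanley_space (fst (D ! i)) (snd (D ! i))"
      using p by (auto simp: f_def g_def stanley_space_eq)
    moreover have "(\<Sum>i<length D. f i) = (\<Sum>i<length D. g i)"
      using len by (simp add: f_def g_def)
    ultimately have "f 0 = g 0"
      using D(2) len unfolding internal_direct_sum_def by blast
    then have "Poly_Mapping.lookup p (fst (D ! 0) + fst (D ! 1)) = 0"
      by (simp add: f_def g_def)
    then show False
      by (simp add: p_def monom_def)
  qed
  then obtain u where "D = [(u, UNIV)]"
    using full[of 0] by (cases D) (auto simp: prod_eq_iff)
  then have "I = {f 0 | f. f (0 :: nat) \<in> (stanley_space u UNIV :: ('x, 'k) mpoly set)}"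
    using D(2) by (simp add: internal_direct_sum_def)
  also have "\<dots> = stanley_space u UNIV"
  proof -
    \<comment> \<open>Every element is the value at 0 of a constant family, so the one-term sums are
      exactly the Stanley space.\<close>
    have "\<exists>f. p = f (0 :: nat) \<and> f 0 \<in> A" if "p \<in> A" for p :: "('x, 'k) mpoly" and A
      using that by (intro exI[of _ "\<lambda>_. p"]) simp
    then show ?thesis by blast
  qed
  also have "\<dots> = ideal_generated {monom u}"
  proof -
    have "p \<in> ideal_generated {monom u} \<longleftrightarrow> Poly_Mapping.keys p \<subseteq> cone u UNIV"
      for p :: "('x, 'k) mpoly"
    proof
      assume "p \<in> ideal_generated {monom u}"
      then obtain q where "p = q * monom u"
        by (auto simp: ring_module.span_singleton)
      then show "Poly_Mapping.keys p \<subseteq> cone u UNIV"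
        using keys_mult[of q "monom u"] by (auto simp: monom_def cone_def add.commute)
    next
      assume "Poly_Mapping.keys p \<subseteq> cone u UNIV"
      then have "Poly_Mapping.single k (Poly_Mapping.lookup p k) \<in> ideal_generated {monom u}"
        if "k \<in> Poly_Mapping.keys p" for k
      proof -
        have "k \<in> cone u UNIV"
          using that \<open>Poly_Mapping.keys p \<subseteq> cone u UNIV\<close> by blast
        then obtain w where "k = u + w"
          by (auto simp: cone_def)
        then have "Poly_Mapping.single k (Poly_Mapping.lookup p k)
            = Poly_Mapping.single w (Poly_Mapping.lookup p k) * monom u"
          by (simp add: monom_def mult_single add.commute)
        then show ?thesis
          by (auto simp: ring_module.span_singleton)
      qed
      then have "(\<Sum>k\<in>Poly_Mapping.keys p. Poly_Mapping.single k (Poly_Mapping.lookup p k))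
          \<in> ideal_generated {monom u}"
        by (rule ring_module.span_sum)
      then show "p \<in> ideal_generated {monom u}"
        by (simp add: sum_lookup_single)
    qed
    then show ?thesis
      by (auto simp: stanley_space_eq)
  qed
  finally show ?thesis
    by (auto simp: principal_ideal_def)
qed

theorem proposition2p8:
  fixes I :: "(3, 'k::field) mpoly set"
  assumes "monomial_ideal I"
    and "\<not> principal_ideal I"
    and "I = saturation I"
  shows "sdepth I = 2"
proof -
  obtain E where I: "I = {p. Poly_Mapping.keys p \<subseteq> E}" and up: "\<And>m w. m \<in> E \<Longrightarrow> m + w \<in> E"
    using monomial_ideal_keys[OF assms(1)] by blast
  have "E \<noteq> {}"
  proof
    assume "E = {}"
    \<comment> \<open>With no exponents the ideal is zero, and the zero ideal is principal.\<close>
    then have "I = ideal_generated {0}"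
      by (auto simp: I ring_module.span_singleton)
    then show False
      using assms(2) by (auto simp: principal_ideal_def)
  qed
  moreover have "cone_partition 2 E"
  proof (rule cone_partition_saturated)
    \<comment> \<open>The closure property of \<open>E\<close> is the equation
      \<open>I = saturation I\<close> read on the monomial with exponent \<open>m\<close>.\<close>
    fix m assume m: "\<And>x. m + Poly_Mapping.single x 1 \<in> E"
    obtain G where "I = ideal_generated G"
      using assms(1) by (auto simp: monomial_ideal_def)
    moreover have "monom m * var x \<in> I" for x
      using m by (simp add: I monom_def var_def mult_single)
    ultimately have "monom m \<in> saturation I"
      by (rule monom_times_mem_saturation)
    then show "m \<in> E"
      using assms(3) by (simp add: I monom_def)
  qed (fact up)
  ultimately obtain D where D: "stanley_decomposition I D" "2 \<le> decomp_sdepth D"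
    unfolding I using cone_partition_stanley_decomposition by metis
  \<comment> \<open>A depth above 2 is at least \<open>CARD(3)\<close>, which would make
    \<open>I\<close> principal. The same bound provides the finiteness that \<open>Max\<close>
    requires.\<close>
  have le: "decomp_sdepth D' \<le> 2" if "stanley_decomposition I D'" for D'
    using principal_ideal_of_full_depth[OF that] assms(2) by fastforce
  show ?thesis
    unfolding sdepth_def
  proof (rule Max_eqI)
    show "finite {decomp_sdepth D | D. stanley_decomposition I D}"
      by (rule finite_subset[of _ "{..2}"]) (use le in auto)
    have "decomp_sdepth D = 2"
      using D le[of D] by simp
    then show "2 \<in> {decomp_sdepth D | D. stanley_decomposition I D}"
      using D(1) by (intro CollectI exI[of _ D]) simp
  qed (use le in auto)
qed

end
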